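(* Fix a positive integer $n$. Let $G_1,G_2,\dots,G_n$ be S-good finite abelian groups with $|G_1|=\cdots=|G_n|=M$, and let $\mathcal{G}=G_1\times G_2\times\cdots\times G_n$. Then for every $0<\delta<1$, $$R_{\mathcal{G}}(\delta)=\frac{1}{2-\delta}\,(1+o(1)),$$ where $o(1)\to 0$ as $M\to\infty$ ($n$ fixed).
   Context: For a finite abelian group $G$ and $A\subseteq G$, the additive energy is $E_G(A):=|\{(a_1,a_2,a_3,a_4)\in A^4:\ a_1+a_2=a_3+a_4\}|$. For $0<\delta<1$, define $R_G(\delta):=\max\{\alpha:\ \exists A\subseteq G \text{ with } |A|=|G|^{\alpha} \text{ and } E_G(A)=|A|^{2+\delta}\}$. A set $S\subseteq G$ is a Sidon set if whenever $s_1+s_2=s_3+s_4$ with $s_i\in S$, then $\{s_1,s_2\}=\{s_3,s_4\}$. A finite abelian group $G$ (more precisely, a family of such groups with $|G|\to\infty$) is called S-good if it contains a Sidon set $S$ with $|S|=(1+o(1))\sqrt{|G|}$.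
   Formalization: The equality E_G(A)=|A|^{2+δ} in the definition of R_G is relaxed to hold up to a factor K with K ≥ κ > 1 and K = M^{o(1)}; with exact equality only singletons qualify for all but countably many δ, giving R_G(δ)=0. *)

theory Defs
  imports Complex_Main "HOL-Algebra.Product_Groups" "HOL-Library.Landau_Symbols"
begin

text \<open>Abelian groups are \<open>comm_group\<close>s, so the group operation is written multiplicatively.\<close>

definition add_energy :: "('a, 'b) monoid_scheme \<Rightarrow> 'a set \<Rightarrow> nat" where
  "add_energy G A = card {(a1, a2, a3, a4). a1 \<in> A \<and> a2 \<in> A \<and> a3 \<in> A \<and> a4 \<in> A \<and>
      a1 \<otimes>\<^bsub>G\<^esub> a2 = a3 \<otimes>\<^bsub>G\<^esub> a4}"

definition sidon_set :: "('a, 'b) monoid_scheme \<Rightarrow> 'a set \<Rightarrow> bool" where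
  "sidon_set G S \<longleftrightarrow> S \<subseteq> carrier G \<and>
     (\<forall>s1\<in>S. \<forall>s2\<in>S. \<forall>s3\<in>S. \<forall>s4\<in>S.
        s1 \<otimes>\<^bsub>G\<^esub> s2 = s3 \<otimes>\<^bsub>G\<^esub> s4 \<longrightarrow> {s1, s2} = {s3, s4})"

text \<open>Being S-good is a property of a family of groups, here a sequence.\<close>

definition S_good :: "(nat \<Rightarrow> ('a, 'b) monoid_scheme) \<Rightarrow> bool" where
  "S_good H \<longleftrightarrow>
     (\<forall>k. comm_group (H k) \<and> finite (carrier (H k))) \<and>
     filterlim (\<lambda>k. order (H k)) at_top sequentially \<and>
     (\<exists>S. (\<forall>k. sidon_set (H k) (S k)) \<and>
          (\<lambda>k. real (card (S k))) \<sim>[sequentially] (\<lambda>k. sqrt (real (order (H k)))))"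

text \<open>
  The largest \<open>\<alpha>\<close> such that some set of size \<open>|G|\<close> to the power \<open>\<alpha>\<close> has energy \<open>|A|\<close> to the power
  \<open>2 + \<delta>\<close>, up to a factor \<open>K\<close>. The case \<open>K = 1\<close> is exact equality. This is too rigid for
  asymptotic statements: for all but countably many \<open>\<delta>\<close> no integer \<open>N \<ge> 2\<close> has an integral power
  \<open>N powr (2 + \<delta>)\<close>, so only singletons would qualify and the maximum would be 0. The
  equality is therefore understood asymptotically, with \<open>K\<close> allowed to depend on the group.

  Singletons make the set of exponents nonempty for \<open>K \<ge> 1\<close>. It is finite if \<open>2 \<le> |G| < \<infinity>\<close>.
\<close>

definition R_exponent :: "real \<Rightarrow> ('a, 'b) monoid_scheme \<Rightarrow> real \<Rightarrow> real" where
  "R_exponent K G \<delta> = Max {\<alpha>. \<exists>A \<subseteq> carrier G.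
      real (card A) = real (order G) powr \<alpha> \<and>
      real (card A) powr (2 + \<delta>) / K \<le> real (add_energy G A) \<and>
      real (add_energy G A) \<le> K * real (card A) powr (2 + \<delta>)}"

end

(*
  By Cauchy-Schwarz |A|^4 <= |G| E(A) in every finite abelian group, so E(A) <= K |A|^(2 + d) forces
  |A|^(2 - d) <= K |G|. Conversely, adjoining a suitable element to A costs at most the average energy
  increment over the complement of A, and a greedy choice gives for every m < |G| a set of size m with
  m^4 / |G| <= E(A) <= m^4 / (|G| - m) + 3 m^2. For m the integer part of |G|^(1 / (2 - d)) both
  bounds are (1 + o(1)) m^(2 + d).
*)
theory Submission
  imports Defs "HOL-Analysis.Convex"
begin

section \<open>Bounds for the additive energy in a finite abelian group\<close>

text \<open>The energy is the sum of the squares of the representation counts \<open>r g\<close>,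
  and these counts add up to \<open>card A ^ 2\<close>. Cauchy-Schwarz over all of
  \<open>carrier G\<close> then gives the bound.\<close>

lemma (in comm_group) add_energy_lower_bound:
  assumes fin: "finite (carrier G)" and A: "A \<subseteq> carrier G"
  shows "real (card A) ^ 4 \<le> real (order G) * real (add_energy G A)"
proof -
  define \<mu> where "\<mu> p = fst p \<otimes> snd p" for p
  define r where "r g = card {p \<in> A \<times> A. \<mu> p = g}" for g
  have fin2: "finite (A \<times> A)" using fin A finite_subset by blast
  have img: "\<mu> ` (A \<times> A) \<subseteq> carrier G" using A by (auto simp: \<mu>_def subset_iff)
  note group = sum.group[OF fin2 fin img]
  have fib: "(\<Sum>g\<in>carrier G. r g) = card (A \<times> A)"
    using group[of "\<lambda>_. 1 :: nat"] by (simp add: r_def)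
  \<comment> \<open>A quadruple is read as two pairs with the same product. Summing over the first
    pair and then grouping by its product \<open>g\<close> gives \<open>r g\<close> pairs with
    \<open>r g\<close> partners each.\<close>
  have "add_energy G A = card (SIGMA p:A \<times> A. {q \<in> A \<times> A. \<mu> q = \<mu> p})"
    unfolding add_energy_def
    by (intro bij_betw_same_card[of "\<lambda>(a, b, c, d). ((a, b), (c, d))"]
        bij_betw_byWitness[where f' = "\<lambda>((a, b), (c, d)). (a, b, c, d)"])
      (simp_all add: \<mu>_def split_beta image_subset_iff)
  also have "\<dots> = (\<Sum>p\<in>A \<times> A. r (\<mu> p))"
    using fin2 unfolding r_def by (intro card_SigmaI) auto
  also have "\<dots> = (\<Sum>g\<in>carrier G. (r g)\<^sup>2)"
    unfolding group[of "\<lambda>p. r (\<mu> p)", symmetric]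
    by (intro sum.cong refl) (simp add: r_def power2_eq_square)
  finally have energy: "add_energy G A = (\<Sum>g\<in>carrier G. (r g)\<^sup>2)" .
  have "real (card A) ^ 4 = (\<Sum>g\<in>carrier G. real (r g))\<^sup>2"
    using fib by (simp flip: of_nat_sum add: card_cartesian_product power2_eq_square power4_eq_xxxx)
  also have "\<dots> \<le> card (carrier G) * (\<Sum>g\<in>carrier G. (real (r g))\<^sup>2)"
    by (subst mult.commute) (rule sum_squared_le_sum_of_squares)
  finally show ?thesis by (simp add: energy order_def)
qed

text \<open>The new quadruples are sorted by the positions of \<open>x\<close>. With one
  \<open>x\<close> there are four positions, each giving a copy of the triple set. With two there
  are six patterns, in each of which a single element of \<open>A\<close> fixes the rest. With
  three, cancellation forces the fourth entry to be \<open>x\<close>, which leaves one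
  quadruple.\<close>

lemma (in comm_group) add_energy_insert_le:
  assumes finA: "finite A" and A: "A \<subseteq> carrier G" and x: "x \<in> carrier G" "x \<notin> A"
  shows "add_energy G (insert x A) \<le> add_energy G A
    + 4 * card {(a, b, c). a \<in> A \<and> b \<in> A \<and> c \<in> A \<and> x \<otimes> a = b \<otimes> c} + 6 * card A + 1"
proof -
  define T where "T = {(a, b, c). a \<in> A \<and> b \<in> A \<and> c \<in> A \<and> x \<otimes> a = b \<otimes> c}"
  define Q where "Q B = {(a1, a2, a3, a4). a1 \<in> B \<and> a2 \<in> B \<and> a3 \<in> B \<and> a4 \<in> B \<and>
    a1 \<otimes> a2 = a3 \<otimes> a4}" for B
  have finT: "finite T"
    by (rule finite_subset[of _ "A \<times> A \<times> A"]) (use finA in \<open>auto simp: T_def\<close>)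
  have finQ: "finite (Q A)"
    by (rule finite_subset[of _ "A \<times> A \<times> A \<times> A"]) (use finA in \<open>auto simp: Q_def\<close>)
  \<comment> \<open>\<open>?I a\<close> is the only possible partner of \<open>a\<close> when the
    other side is \<open>x \<otimes> x\<close>. It may lie outside \<open>A\<close>, which is
    harmless since \<open>?U\<close> only has to cover. The list has the old quadruples, four sets
    with one \<open>x\<close>, two with both \<open>x\<close> on one side, four with an
    \<open>x\<close> on each side, and the constant quadruple.\<close>
  let ?I = "\<lambda>a. inv a \<otimes> (x \<otimes> x)"
  let ?U = "[Q A, (\<lambda>(a, b, c). (x, a, b, c)) ` T, (\<lambda>(a, b, c). (a, x, b, c)) ` T,
    (\<lambda>(a, b, c). (b, c, x, a)) ` T, (\<lambda>(a, b, c). (b, c, a, x)) ` T,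
    (\<lambda>a. (x, x, a, ?I a)) ` A, (\<lambda>a. (a, ?I a, x, x)) ` A,
    (\<lambda>a. (x, a, x, a)) ` A, (\<lambda>a. (x, a, a, x)) ` A,
    (\<lambda>a. (a, x, x, a)) ` A, (\<lambda>a. (a, x, a, x)) ` A, {(x, x, x, x)}]"
  have "Q (insert x A) \<subseteq> \<Union> (set ?U)"
  proof
    fix q assume "q \<in> Q (insert x A)"
    then obtain a b c d where q: "q = (a, b, c, d)"
      and ins: "a = x \<or> a \<in> A" "b = x \<or> b \<in> A" "c = x \<or> c \<in> A" "d = x \<or> d \<in> A"
      and eq: "a \<otimes> b = c \<otimes> d"
      by (auto simp: Q_def)
    have cl: "a \<in> carrier G" "b \<in> carrier G" "c \<in> carrier G" "d \<in> carrier G"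
      using ins A x by auto
    have canc: "(a = c) = (b = d)" and canc': "(a = d) = (b = c)"
      using eq cl by (metis Units_eq Units_l_cancel right_cancel, metis Units_eq Units_l_cancel m_comm)
    have sol: "b = inv a \<otimes> (c \<otimes> d)" "d = inv c \<otimes> (a \<otimes> b)"
      using eq cl by (simp_all add: inv_solve_left)
    \<comment> \<open>Commutativity moves a single \<open>x\<close> from second to first place on
      its side, so that all four positions fit the shape of \<open>T\<close>.\<close>
    have eq': "b \<otimes> a = c \<otimes> d" "d \<otimes> c = a \<otimes> b"
      using eq cl by (simp_all add: m_comm)
    \<comment> \<open>These equivalences rule out exactly three entries equal to
      \<open>x\<close>.\<close>
    have "b = x \<longleftrightarrow> d = x" if "a = x" "c = x" using that canc by simp
    moreover have "b = x \<longleftrightarrow> c = x" if "a = x" "d = x" using that canc' by simp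
    moreover have "a = x \<longleftrightarrow> c = x" if "b = x" "d = x" using that canc by simp
    ultimately consider "a \<in> A" "b \<in> A" "c \<in> A" "d \<in> A"
      | "a = x" "b \<in> A" "c \<in> A" "d \<in> A" | "a \<in> A" "b = x" "c \<in> A" "d \<in> A"
      | "a \<in> A" "b \<in> A" "c = x" "d \<in> A" | "a \<in> A" "b \<in> A" "c \<in> A" "d = x"
      | "a = x" "b = x" "c \<in> A" "d \<in> A" | "a \<in> A" "b \<in> A" "c = x" "d = x"
      | "a = x" "c = x" "b \<in> A" | "a = x" "d = x" "b \<in> A" "c \<in> A"
      | "b = x" "c = x" "a \<in> A" "d \<in> A" | "b = x" "d = x" "a \<in> A"
      | "a = x" "b = x" "c = x" "d = x"
      using ins by argo
    then show "q \<in> \<Union> (set ?U)"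
    proof cases
      case 1 then have "q \<in> Q A" by (simp add: Q_def q eq)
      then show ?thesis by simp
    next
      case 2 then have "(b, c, d) \<in> T" using eq by (simp add: T_def)
      then have "q \<in> (\<lambda>(a, b, c). (x, a, b, c)) ` T" using 2 q by force
      then show ?thesis by simp
    next
      case 3 then have "(a, c, d) \<in> T" using eq' by (simp add: T_def)
      then have "q \<in> (\<lambda>(a, b, c). (a, x, b, c)) ` T" using 3 q by force
      then show ?thesis by simp
    next
      case 4 then have "(d, a, b) \<in> T" using eq by (simp add: T_def)
      then have "q \<in> (\<lambda>(a, b, c). (b, c, x, a)) ` T" using 4 q by force
      then show ?thesis by simp
    next
      case 5 then have "(c, a, b) \<in> T" using eq' by (simp add: T_def)
      then have "q \<in> (\<lambda>(a, b, c). (b, c, a, x)) ` T" using 5 q by force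
      then show ?thesis by simp
    next
      case 6 then have "q \<in> (\<lambda>a. (x, x, a, ?I a)) ` A" using q sol(2) by (intro image_eqI[of _ _ c]) simp_all
      then show ?thesis by simp
    next
      case 7 then have "q \<in> (\<lambda>a. (a, ?I a, x, x)) ` A" using q sol(1) by (intro image_eqI[of _ _ a]) simp_all
      then show ?thesis by simp
    qed (use q canc canc' in auto)
  qed
  then have "card (Q (insert x A)) \<le> card (\<Union> (set ?U))"
    by (rule card_mono[rotated]) (use finA finQ finT in auto)
  also have "card (\<Union> (set Us)) \<le> sum_list (map card Us)" for Us :: "('a \<times> 'a \<times> 'a \<times> 'a) set list"
    by (induction Us) (auto intro: order_trans[OF card_Un_le])
  also have "sum_list (map card ?U) \<le> card (Q A) + 4 * card T + 6 * card A + 1"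
  proof -
    have "sum_list (map card ?U) \<le> sum_list [card (Q A), card T, card T, card T, card T,
      card A, card A, card A, card A, card A, card A, 1]"
      unfolding list.map sum_list.Cons sum_list.Nil
      by (intro add_mono card_image_le finT finA order_refl) simp
    also have "\<dots> = card (Q A) + 4 * card T + 6 * card A + 1"
      by simp
    finally show ?thesis .
  qed
  finally show ?thesis by (simp add: add_energy_def Q_def T_def)
qed

text \<open>A triple determines \<open>x\<close> as the product of \<open>b\<close>,
  \<open>c\<close> and \<open>inv a\<close>, so the triple sets of different \<open>x\<close> are
  disjoint parts of \<open>A \<times> A \<times> A\<close>. An \<open>x\<close> outside
  \<open>A\<close> with the fewest triples has at most the average number.\<close>

lemma (in comm_group) exists_few_representations:
  assumes fin: "finite (carrier G)" and A: "A \<subset> carrier G"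
  shows "\<exists>x\<in>carrier G - A.
    (order G - card A) * card {(a, b, c). a \<in> A \<and> b \<in> A \<and> c \<in> A \<and> x \<otimes> a = b \<otimes> c}
      \<le> card A ^ 3"
proof -
  define T where "T x = {(a, b, c). a \<in> A \<and> b \<in> A \<and> c \<in> A \<and> x \<otimes> a = b \<otimes> c}" for x
  have finA: "finite A" using fin A finite_subset by blast
  have T_sub: "T x \<subseteq> A \<times> A \<times> A" for x by (auto simp: T_def)
  have finT: "finite (T x)" for x
    using finite_subset[OF T_sub] finA by simp
  have T_disj: "T x \<inter> T y = {}" if "x \<in> carrier G" "y \<in> carrier G" "x \<noteq> y" for x y
  proof -
    have "x = y" if "a \<in> A" "x \<otimes> a = b \<otimes> c" "y \<otimes> a = b \<otimes> c" for a b c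
      using that psubsetD[OF A] \<open>x \<in> carrier G\<close> \<open>y \<in> carrier G\<close> right_cancel[of a x y] by simp
    then show ?thesis
      using \<open>x \<noteq> y\<close> unfolding T_def by blast
  qed
  have "(\<Sum>x\<in>carrier G - A. card (T x)) = card (\<Union>x\<in>carrier G - A. T x)"
    by (rule card_UN_disjoint[symmetric]) (use fin finT T_disj in auto)
  also have "\<dots> \<le> card (A \<times> A \<times> A)"
    by (rule card_mono) (use finA T_sub in auto)
  finally have total: "(\<Sum>x\<in>carrier G - A. card (T x)) \<le> card A ^ 3"
    by (simp add: card_cartesian_product power3_eq_cube)
  obtain x where x: "x \<in> carrier G - A" and min: "\<And>y. y \<in> carrier G - A \<Longrightarrow> card (T x) \<le> card (T y)"
    using ex_has_least_nat[of "\<lambda>x. x \<in> carrier G - A" _ "\<lambda>x. card (T x)"] A by blast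
  have "card (carrier G - A) * card (T x) \<le> (\<Sum>x\<in>carrier G - A. card (T x))"
    using sum_bounded_below[of "carrier G - A" "card (T x)" "\<lambda>x. card (T x)"] min by simp
  moreover have "card (carrier G - A) = order G - card A"
    using A finA by (simp add: order_def card_Diff_subset)
  ultimately show ?thesis using total x unfolding T_def by (intro bexI[of _ x]) auto
qed

lemma (in comm_group) exists_small_add_energy:
  assumes fin: "finite (carrier G)" and m: "m < order G"
  shows "\<exists>A\<subseteq>carrier G. card A = m \<and>
    real (add_energy G A) \<le> real m ^ 4 / (real (order G) - real m) + 3 * real m ^ 2"
proof -
  \<comment> \<open>The denominator is fixed at its value for the final size. At each earlier size
    the complement has more than \<open>D\<close> elements, so one inductive bound serves all
    \<open>j \<le> m\<close>.\<close>
  define D where "D = real (order G) - real m"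
  have D: "D > 0" using m by (simp add: D_def)
  have "\<exists>A\<subseteq>carrier G. card A = j \<and> real (add_energy G A) \<le> real j ^ 4 / D + 3 * real j ^ 2"
    if "j \<le> m" for j
    using that
  proof (induction j)
    case 0
    then show ?case by (intro exI[of _ "{}"]) (auto simp: add_energy_def card_eq_0_iff)
  next
    case (Suc j)
    then obtain A where A: "A \<subseteq> carrier G" "card A = j"
      and E: "real (add_energy G A) \<le> real j ^ 4 / D + 3 * real j ^ 2"
      by auto
    have finA: "finite A" using fin A finite_subset by blast
    have "A \<subset> carrier G" using A Suc.prems m by (auto simp: order_def)
    from exists_few_representations[OF fin this] obtain x t where x: "x \<in> carrier G" "x \<notin> A"
      and t: "t = card {(a, b, c). a \<in> A \<and> b \<in> A \<and> c \<in> A \<and> x \<otimes> a = b \<otimes> c}"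
      and le: "(order G - j) * t \<le> j ^ 3"
      using A by auto
    have "real (order G - j) * real t \<le> real j ^ 3"
      using le by (metis of_nat_le_iff of_nat_mult of_nat_power)
    moreover have "D * real t \<le> real (order G - j) * real t"
      using Suc.prems m by (intro mult_right_mono) (auto simp: D_def)
    ultimately have t_le: "real t \<le> real j ^ 3 / D"
      using D by (simp add: field_simps)
    have "real (add_energy G (insert x A)) \<le> real (add_energy G A) + 4 * real t + 6 * real j + 1"
      using add_energy_insert_le[OF finA A(1) x] A(2) t by linarith
    also have "\<dots> \<le> (real j ^ 4 + 4 * real j ^ 3) / D + (3 * real j ^ 2 + 6 * real j + 1)"
      using E t_le by (simp add: add_divide_distrib)
    \<comment> \<open>Both increments telescope: \<open>4 * j ^ 3\<close> is at most the growth of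
      \<open>j ^ 4\<close>, and \<open>6 * j + 1\<close> is at most \<open>6 * j + 3\<close>, the
      growth of \<open>3 * j ^ 2\<close>.\<close>
    also have "\<dots> \<le> real (Suc j) ^ 4 / D + 3 * real (Suc j) ^ 2"
      using D by (intro add_mono divide_right_mono)
        (auto simp: power2_eq_square power4_eq_xxxx power3_eq_cube algebra_simps)
    finally have "real (add_energy G (insert x A)) \<le> real (Suc j) ^ 4 / D + 3 * real (Suc j) ^ 2" .
    then show ?case using x A finA by (intro exI[of _ "insert x A"]) auto
  qed
  from this[of m] show ?thesis by (simp add: D_def)
qed

section \<open>Direct products\<close>

lemma comm_group_product_group:
  assumes "\<And>i. i \<in> I \<Longrightarrow> comm_group (G i)"
  shows "comm_group (product_group I G)"
proof (rule group.group_comm_groupI)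
  show "group (product_group I G)"
    using assms by (simp add: comm_group.axioms(2))
next
  fix x y assume "x \<in> carrier (product_group I G)" "y \<in> carrier (product_group I G)"
  then show "x \<otimes>\<^bsub>product_group I G\<^esub> y = y \<otimes>\<^bsub>product_group I G\<^esub> x"
    using assms
    by (auto simp: mult_product_group PiE_def Pi_def restrict_def fun_eq_iff
        intro!: comm_monoid.m_comm[OF comm_group.axioms(1)])
qed

lemma order_product_group:
  "finite I \<Longrightarrow> order (product_group I G) = (\<Prod>i\<in>I. order (G i))"
  by (simp add: order_def card_PiE)

section \<open>Admissible exponents and their maximum\<close>

text \<open>This is the set under \<open>Max\<close> in \<open>R_exponent\<close>. Naming it lets
  nonemptiness be carried as a fact of its own, since \<open>Max\<close> says nothing about the
  empty set.\<close>

definition energy_exponents :: "real \<Rightarrow> ('a, 'b) monoid_scheme \<Rightarrow> real \<Rightarrow> real set" where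
  "energy_exponents K G \<delta> = {\<alpha>. \<exists>A \<subseteq> carrier G.
      real (card A) = real (order G) powr \<alpha> \<and>
      real (card A) powr (2 + \<delta>) / K \<le> real (add_energy G A) \<and>
      real (add_energy G A) \<le> K * real (card A) powr (2 + \<delta>)}"

lemma finite_energy_exponents:
  assumes "finite (carrier G)" and "order G \<ge> 2"
  shows "finite (energy_exponents K G \<delta>)"
proof (rule finite_subset)
  \<comment> \<open>Since the order is at least 2, the exponent is recovered from \<open>A\<close>
    as a logarithm, and there are finitely many \<open>A\<close>.\<close>
  show "energy_exponents K G \<delta> \<subseteq> (\<lambda>A. log (real (order G)) (real (card A))) ` Pow (carrier G)"
  proof
    fix \<alpha> assume "\<alpha> \<in> energy_exponents K G \<delta>"
    then obtain A where "A \<subseteq> carrier G" "real (card A) = real (order G) powr \<alpha>"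
      unfolding energy_exponents_def by blast
    then show "\<alpha> \<in> (\<lambda>A. log (real (order G)) (real (card A))) ` Pow (carrier G)"
      using assms(2) by (intro image_eqI[of _ _ A]) auto
  qed
qed (use assms in simp)

lemma R_exponent_ge:
  assumes fin: "finite (carrier G)" and ord: "order G \<ge> 2"
    and A: "A \<subseteq> carrier G" "A \<noteq> {}"
    and E: "real (card A) powr (2 + \<delta>) / K \<le> real (add_energy G A)"
      "real (add_energy G A) \<le> K * real (card A) powr (2 + \<delta>)"
  shows "ln (real (card A)) / ln (real (order G)) \<le> R_exponent K G \<delta>"
proof -
  have "card A > 0" using A fin by (simp add: card_gt_0_iff finite_subset)
  then have "real (card A) = real (order G) powr (ln (real (card A)) / ln (real (order G)))"
    using ord by (simp add: powr_def)
  then have "ln (real (card A)) / ln (real (order G)) \<in> energy_exponents K G \<delta>"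
    using A E by (auto simp: energy_exponents_def)
  then show ?thesis
    unfolding R_exponent_def energy_exponents_def[symmetric]
    by (rule Max_ge[OF finite_energy_exponents[OF fin ord]])
qed

text \<open>Cancelling the power \<open>2 + \<delta>\<close> of \<open>card A\<close> in the
  Cauchy-Schwarz bound and taking logarithms bounds every admissible exponent. The tolerance
  \<open>K\<close> enters only through \<open>ln K / ln (order G)\<close>, which vanishes for
  subpolynomial \<open>K\<close>. Nonemptiness puts the maximum itself among the exponents.\<close>

lemma (in comm_group) R_exponent_le:
  assumes fin: "finite (carrier G)" and ord: "order G \<ge> 2" and K: "K > 0" and \<delta>: "\<delta> < 2"
    and ne: "energy_exponents K G \<delta> \<noteq> {}"
  shows "R_exponent K G \<delta> \<le> (1 + ln K / ln (real (order G))) / (2 - \<delta>)"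
proof -
  let ?N = "real (order G)"
  have "\<alpha> \<le> (1 + ln K / ln ?N) / (2 - \<delta>)" if \<alpha>: "\<alpha> \<in> energy_exponents K G \<delta>" for \<alpha>
  proof -
    obtain A where A: "A \<subseteq> carrier G" and c: "real (card A) = ?N powr \<alpha>"
      and E: "real (add_energy G A) \<le> K * real (card A) powr (2 + \<delta>)"
      using \<alpha> unfolding energy_exponents_def by (elim CollectE exE conjE) (rule that)
    have pos: "real (card A) > 0" using c ord by simp
    have "real (card A) powr 4 \<le> ?N * (K * real (card A) powr (2 + \<delta>))"
      using add_energy_lower_bound[OF fin A] mult_left_mono[OF E, of ?N] pos
      by (simp add: powr_realpow[of _ 4, simplified])
    moreover have "real (card A) powr 4 = real (card A) powr (2 - \<delta>) * real (card A) powr (2 + \<delta>)"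
      by (simp flip: powr_add)
    ultimately have "real (card A) powr (2 - \<delta>) \<le> ?N * K"
      using pos by simp
    then have "ln (real (card A) powr (2 - \<delta>)) \<le> ln (?N * K)"
      using pos ord K by (subst ln_le_cancel_iff) auto
    then have "(2 - \<delta>) * (\<alpha> * ln ?N) \<le> ln ?N + ln K"
      using c ord K pos by (simp add: ln_powr ln_mult)
    moreover have "ln ?N > 0" using ord by simp
    ultimately show ?thesis using \<delta> by (simp add: field_simps)
  qed
  then show ?thesis
    unfolding R_exponent_def energy_exponents_def[symmetric]
    using Max_in[OF finite_energy_exponents[OF fin ord] ne] by blast
qed

section \<open>Sets of nearly critical size and the lower bound for the exponent\<close>

text \<open>
  Here \<open>x\<close> is the order of the group and \<open>y\<close> the size of the set. The two bounds on \<open>e\<close> are those of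
  \<open>add_energy_lower_bound\<close> and \<open>exists_small_add_energy\<close>.
\<close>

lemma energy_window:
  fixes x y \<delta> \<kappa> e :: real
  defines "a \<equiv> 1 / (2 - \<delta>)"
  assumes \<delta>: "0 < \<delta>" "\<delta> < 1" and \<kappa>: "\<kappa> > 0"
    and x: "x powr a < x" "3 < x powr a"
    and low: "1 / \<kappa> \<le> (1 - x powr (-a)) powr (2 - \<delta>)"
    and upp: "x / (x - x powr a) + 3 * (x powr a - 1) powr (-\<delta>) \<le> \<kappa>"
    and y: "x powr a - 1 \<le> y" "y \<le> x powr a"
    and e: "y ^ 4 / x \<le> e" "e \<le> y ^ 4 / (x - y) + 3 * y ^ 2"
  shows "y powr (2 + \<delta>) / \<kappa> \<le> e" and "e \<le> \<kappa> * y powr (2 + \<delta>)"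
proof -
  have y0: "y > 0" and x0: "x > 0" and yx: "y < x" using x y by linarith+
  \<comment> \<open>The critical size: at \<open>y = x powr a\<close> the terms
    \<open>y ^ 4 / x\<close> and \<open>y powr (2 + \<delta>)\<close> coincide.\<close>
  have a: "(x powr a) powr (2 - \<delta>) = x"
    using \<delta> x0 powr_powr[of x a "2 - \<delta>"] by (simp add: a_def)
  have y4: "y ^ 4 = y powr (2 - \<delta>) * y powr (2 + \<delta>)"
    using y0 powr_realpow[of y 4] by (simp flip: powr_add)
  have y2: "y ^ 2 = y powr (-\<delta>) * y powr (2 + \<delta>)"
    using y0 powr_realpow[of y 2] by (simp flip: powr_add)
  have inv: "x powr a * x powr (-a) = 1"
    using x0 by (simp flip: powr_add)
  have lt1: "x powr (-a) < 1"
    using x by (simp add: powr_minus field_simps)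
  \<comment> \<open>Rounding the critical size down by at most 1 costs at most the factor bounded in
    \<open>low\<close>.\<close>
  have "x * (1 - x powr (-a)) powr (2 - \<delta>) = (x powr a * (1 - x powr (-a))) powr (2 - \<delta>)"
    using lt1 by (simp add: powr_mult a)
  also have "\<dots> = (x powr a - 1) powr (2 - \<delta>)"
    using inv by (simp add: algebra_simps)
  also have "\<dots> \<le> y powr (2 - \<delta>)"
    using x y \<delta> by (intro powr_mono2) auto
  finally have "x / \<kappa> \<le> y powr (2 - \<delta>)"
    using mult_left_mono[OF low, of x] x0 by simp
  then have "1 / \<kappa> \<le> y powr (2 - \<delta>) / x"
    using x0 \<kappa> by (simp add: field_simps)
  from mult_right_mono[OF this, of "y powr (2 + \<delta>)"] show "y powr (2 + \<delta>) / \<kappa> \<le> e"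
    using e(1) by (simp add: y4)
  \<comment> \<open>After division by \<open>y powr (2 + \<delta>)\<close> the upper bound for
    \<open>e\<close> has two terms. The first is largest at the top end of the range of
    \<open>y\<close>, the second at the bottom end, and \<open>upp\<close> bounds the sum of these
    two extremes.\<close>
  have "y powr (2 - \<delta>) \<le> x"
    using powr_mono2[of "2 - \<delta>" y "x powr a"] a \<delta> y y0 by simp
  then have "y powr (2 - \<delta>) / (x - y) \<le> x / (x - x powr a)"
    using x y x0 by (intro frac_le) auto
  moreover have "y powr (-\<delta>) \<le> (x powr a - 1) powr (-\<delta>)"
    using x y \<delta> by (intro powr_mono2') auto
  ultimately have "y powr (2 - \<delta>) / (x - y) + 3 * y powr (-\<delta>) \<le> \<kappa>"
    using upp by linarith
  from mult_right_mono[OF this, of "y powr (2 + \<delta>)"] show "e \<le> \<kappa> * y powr (2 + \<delta>)"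
    using e(2) by (simp add: y4 y2 algebra_simps)
qed

text \<open>Factoring out \<open>x powr a\<close> turns the quotient into \<open>a\<close> plus
  \<open>ln (1 - x powr (-a)) / ln x\<close>, which tends to 0. Hence rounding the critical size to
  an integer does not change the limiting exponent.\<close>

lemma ln_powr_minus_one_ratio_tendsto:
  assumes "a > (0 :: real)"
  shows "((\<lambda>x. ln (x powr a - 1) / ln x) \<longlongrightarrow> a) at_top"
proof (rule Lim_transform_eventually)
  have neg: "((\<lambda>x. x powr (-a)) \<longlongrightarrow> 0) at_top"
    by (rule tendsto_neg_powr[OF _ filterlim_ident]) (use assms in simp)
  have "((\<lambda>x. ln (1 - x powr (-a))) \<longlongrightarrow> ln (1 - 0)) at_top"
    by (intro tendsto_intros neg) simp
  then have "((\<lambda>x. ln (1 - x powr (-a)) / ln x) \<longlongrightarrow> 0) at_top"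
    by (rule real_tendsto_divide_at_top[OF _ ln_at_top])
  then show "((\<lambda>x. a + ln (1 - x powr (-a)) / ln x) \<longlongrightarrow> a) at_top"
    using tendsto_add[OF tendsto_const[of a]] by force
  show "\<forall>\<^sub>F x in at_top. a + ln (1 - x powr (-a)) / ln x = ln (x powr a - 1) / ln x"
    using eventually_gt_at_top[of 1]
  proof eventually_elim
    case (elim x)
    have "x powr (-a) < 1" using elim assms powr_less_mono[of "-a" 0 x] by simp
    moreover have "x powr a - 1 = x powr a * (1 - x powr (-a))"
      using elim by (simp add: right_diff_distrib flip: powr_add)
    ultimately have "ln (x powr a - 1) = a * ln x + ln (1 - x powr (-a))"
      using elim by (simp add: ln_mult ln_powr)
    then show ?case using elim by (simp add: field_simps)
  qed
qed

text \<open>A set of size \<open>\<lfloor>x powr a\<rfloor>\<close> with small energy lies in the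
  window of the fixed \<open>\<kappa>\<close>, hence in that of every larger \<open>K\<close>. The
  threshold for \<open>x\<close> depends only on \<open>\<delta>\<close> and
  \<open>\<kappa>\<close>; this uniformity in \<open>G\<close> and \<open>K\<close> allows
  substituting a sequence of groups with varying \<open>K\<close>.\<close>

lemma eventually_R_exponent_ge:
  fixes \<delta> \<kappa> :: real
  defines "a \<equiv> 1 / (2 - \<delta>)"
  assumes \<delta>: "0 < \<delta>" "\<delta> < 1" and \<kappa>: "\<kappa> > 1"
  shows "\<forall>\<^sub>F x in at_top. \<forall>(G :: ('a, 'b) monoid_scheme) K.
    comm_group G \<longrightarrow> finite (carrier G) \<longrightarrow> real (order G) = x \<longrightarrow> \<kappa> \<le> K \<longrightarrow>
    energy_exponents K G \<delta> \<noteq> {} \<and> ln (x powr a - 1) / ln x \<le> R_exponent K G \<delta>"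
proof -
  have a: "0 < a" "a < 1" using \<delta> by (auto simp: a_def)
  have neg: "((\<lambda>x. x powr s) \<longlongrightarrow> 0) at_top" if "s < 0" for s :: real
    using that filterlim_ident by (rule tendsto_neg_powr)
  have top: "filterlim (\<lambda>x. x powr a) at_top at_top"
  proof (rule filterlim_cong[OF refl refl, THEN iffD1])
    show "filterlim (\<lambda>x. exp (a * ln x)) at_top at_top"
      by (intro filterlim_compose[OF exp_at_top]
          filterlim_tendsto_pos_mult_at_top[OF tendsto_const a(1) ln_at_top])
    show "\<forall>\<^sub>F x in at_top. exp (a * ln x) = x powr a"
      using eventually_gt_at_top[of 0] by eventually_elim (simp add: powr_def)
  qed
  have "((\<lambda>x. (1 - x powr (-a)) powr (2 - \<delta>)) \<longlongrightarrow> (1 - 0) powr (2 - \<delta>)) at_top"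
    using a by (intro tendsto_intros neg) auto
  then have "((\<lambda>x. (1 - x powr (-a)) powr (2 - \<delta>)) \<longlongrightarrow> 1) at_top"
    by simp
  then have ev1: "\<forall>\<^sub>F x in at_top. 1 / \<kappa> < (1 - x powr (-a)) powr (2 - \<delta>)"
    by (rule order_tendstoD) (use \<kappa> in simp)
  have "filterlim (\<lambda>x. - 1 + x powr a) at_top at_top"
    by (rule filterlim_tendsto_add_at_top[OF tendsto_const top])
  then have "((\<lambda>x. (x powr a - 1) powr (-\<delta>)) \<longlongrightarrow> 0) at_top"
    using \<delta> by (intro tendsto_neg_powr) simp_all
  \<comment> \<open>The first summand is \<open>x / (x - x powr a)\<close> with \<open>x\<close>
    cancelled. It tends to 1 because \<open>\<delta> < 1\<close> makes \<open>a < 1\<close>; the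
    second vanishes because \<open>\<delta> > 0\<close>. So any \<open>\<kappa> > 1\<close> is
    eventually large enough.\<close>
  then have "((\<lambda>x. 1 / (1 - x powr (a - 1)) + 3 * (x powr a - 1) powr (-\<delta>))
      \<longlongrightarrow> 1 / (1 - 0) + 3 * 0) at_top"
    using a by (intro tendsto_intros neg) auto
  moreover have "\<forall>\<^sub>F x in at_top. 1 / (1 - x powr (a - 1)) + 3 * (x powr a - 1) powr (-\<delta>)
      = x / (x - x powr a) + 3 * (x powr a - 1) powr (-\<delta>)"
    using eventually_gt_at_top[of 0]
  proof eventually_elim
    case (elim x)
    then have "x - x powr a = x * (1 - x powr (a - 1))"
      by (simp add: powr_diff right_diff_distrib)
    then show ?case using elim by simp
  qed
  ultimately have "((\<lambda>x. x / (x - x powr a) + 3 * (x powr a - 1) powr (-\<delta>)) \<longlongrightarrow> 1) at_top"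
    using Lim_transform_eventually by fastforce
  then have ev2: "\<forall>\<^sub>F x in at_top. x / (x - x powr a) + 3 * (x powr a - 1) powr (-\<delta>) < \<kappa>"
    by (rule order_tendstoD) (use \<kappa> in simp)
  have ev3: "\<forall>\<^sub>F x in at_top. x powr a < x"
    using eventually_gt_at_top[of 1]
  proof eventually_elim
    case (elim x)
    then show ?case using powr_less_mono[OF a(2), of x] by simp
  qed
  \<comment> \<open>This keeps \<open>x powr a - 1\<close> positive, so that \<open>m > 0\<close>
    and \<open>ln\<close> is monotone there; with \<open>ev3\<close> it also makes the order at
    least 2.\<close>
  have ev4: "\<forall>\<^sub>F x in at_top. 3 < x powr a"
    using top by (simp add: filterlim_at_top_dense)
  show ?thesis
    using ev1 ev2 ev3 ev4
  proof eventually_elim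
    case (elim x)
    show ?case
    proof (intro allI impI)
      fix G :: "('a, 'b) monoid_scheme" and K
      assume G: "comm_group G" and fin: "finite (carrier G)" and N: "real (order G) = x"
        and K: "\<kappa> \<le> K"
      define m where "m = nat \<lfloor>x powr a\<rfloor>"
      have m: "x powr a - 1 \<le> real m" "real m \<le> x powr a"
        using elim by (simp_all add: m_def)
      have ord: "order G \<ge> 2" using N elim by linarith
      have "m < order G" using m N elim by linarith
      from comm_group.exists_small_add_energy[OF G fin this] obtain A where A: "A \<subseteq> carrier G" "card A = m"
        and upp: "real (add_energy G A) \<le> real m ^ 4 / (x - real m) + 3 * real m ^ 2"
        unfolding N by blast
      have low: "real m ^ 4 / x \<le> real (add_energy G A)"
        using comm_group.add_energy_lower_bound[OF G fin A(1)] N A(2) elim by (simp add: field_simps)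
      have mpos: "m > 0" using m elim by linarith
      have w: "real m powr (2 + \<delta>) / \<kappa> \<le> real (add_energy G A)"
        "real (add_energy G A) \<le> \<kappa> * real m powr (2 + \<delta>)"
        by (rule energy_window[of \<delta> \<kappa> x "real m"];
            use \<delta> \<kappa> elim m upp low in \<open>simp add: a_def\<close>)+
      have "real m powr (2 + \<delta>) / K \<le> real m powr (2 + \<delta>) / \<kappa>"
        using K \<kappa> by (intro divide_left_mono) auto
      with w(1) have w1: "real (card A) powr (2 + \<delta>) / K \<le> real (add_energy G A)"
        by (simp add: A)
      have "\<kappa> * real m powr (2 + \<delta>) \<le> K * real m powr (2 + \<delta>)"
        using K by (intro mult_right_mono) auto
      with w(2) have w2: "real (add_energy G A) \<le> K * real (card A) powr (2 + \<delta>)"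
        by (simp add: A)
      have "real (card A) = real (order G) powr (ln (real m) / ln (real (order G)))"
        using ord mpos A by (simp add: powr_def)
      then have "energy_exponents K G \<delta> \<noteq> {}"
        using A(1) w1 w2 unfolding energy_exponents_def by blast
      moreover have "ln (x powr a - 1) / ln x \<le> ln (real m) / ln x"
        using m elim ord N by (intro divide_right_mono) auto
      moreover have "ln (real m) / ln x \<le> R_exponent K G \<delta>"
        using R_exponent_ge[OF fin ord A(1) _ w1 w2] A(2) mpos N by force
      ultimately show "energy_exponents K G \<delta> \<noteq> {} \<and> ln (x powr a - 1) / ln x \<le> R_exponent K G \<delta>"
        by simp
    qed
  qed
qed

section \<open>The limit along the sequence of products\<close>

theorem theorem3p4:
  fixes n :: nat
    and G :: "nat \<Rightarrow> nat \<Rightarrow> ('a, 'b) monoid_scheme"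
    and M :: "nat \<Rightarrow> nat"
    and \<delta> \<kappa> :: real
    and K :: "nat \<Rightarrow> real"
  assumes "n > 0"
    and "\<And>i. i \<in> {1..n} \<Longrightarrow> S_good (G i)"
    and "\<And>i k. i \<in> {1..n} \<Longrightarrow> order (G i k) = M k"
    and "filterlim M at_top sequentially"
    and "0 < \<delta>" and "\<delta> < 1"
    and "1 < \<kappa>" and "\<And>k. \<kappa> \<le> K k"
    and "(\<lambda>k. ln (K k)) \<in> o(\<lambda>k. ln (real (M k)))"
  shows "(\<lambda>k. R_exponent (K k) (product_group {1..n} (\<lambda>i. G i k)) \<delta>)
           \<sim>[sequentially] (\<lambda>k. 1 / (2 - \<delta>))"
proof -
  define P where "P k = product_group {1..n} (\<lambda>i. G i k)" for k
  define N where "N k = real (order (P k))" for k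
  define a where "a = 1 / (2 - \<delta>)"
  have good: "comm_group (G i k)" "finite (carrier (G i k))" if "i \<in> {1..n}" for i k
    using assms(2)[OF that] by (auto simp: S_good_def)
  have comm: "comm_group (P k)" for k
    unfolding P_def by (rule comm_group_product_group) (rule good)
  have fin: "finite (carrier (P k))" for k
    using good by (auto simp: P_def intro!: finite_PiE)
  have N: "N k = real (M k) ^ n" for k
    using assms(3) by (simp add: N_def P_def order_product_group)
  have N_top: "filterlim N at_top sequentially"
    unfolding N using \<open>n > 0\<close>
    by (intro filterlim_pow_at_top filterlim_compose[OF filterlim_real_sequentially assms(4)]) auto
  \<comment> \<open>The uniform bound is evaluated along \<open>N\<close>, with carrier elements of
    type \<open>nat \<Rightarrow> 'a\<close>. Nonemptiness is kept because the upper bound needs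
    it.\<close>
  have lower: "\<forall>\<^sub>F k in sequentially. energy_exponents (K k) (P k) \<delta> \<noteq> {} \<and>
      ln (N k powr a - 1) / ln (N k) \<le> R_exponent (K k) (P k) \<delta>"
    using eventually_compose_filterlim[OF
      eventually_R_exponent_ge[where 'a = "nat \<Rightarrow> 'a" and 'b = unit, OF assms(5-7)] N_top]
  proof eventually_elim
    case (elim k)
    show ?case
      unfolding a_def
      by (rule elim[rule_format, of "P k", OF comm fin N_def[symmetric] assms(8)])
  qed
  have upper: "\<forall>\<^sub>F k in sequentially. R_exponent (K k) (P k) \<delta> \<le> (1 + ln (K k) / ln (N k)) / (2 - \<delta>)"
    using lower filterlim_at_top[THEN iffD1, OF N_top, rule_format, of 2]
  proof eventually_elim
    case (elim k)
    show ?case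
      unfolding N_def
      by (rule comm_group.R_exponent_le[OF comm fin])
        (use elim assms(6,7) assms(8)[of k] in \<open>auto simp: N_def\<close>)
  qed
  have a: "0 < a" "a < 1" using assms(5,6) by (auto simp: a_def)
  have lim_lower: "(\<lambda>k. ln (N k powr a - 1) / ln (N k)) \<longlonglongrightarrow> a"
    by (rule filterlim_compose[OF ln_powr_minus_one_ratio_tendsto N_top]) (rule a)
  have "(\<lambda>k. ln (K k) / ln (real (M k))) \<longlonglongrightarrow> 0"
    using assms(9) by (rule smalloD_tendsto)
  then have "(\<lambda>k. (1 + ln (K k) / ln (real (M k)) / real n) / (2 - \<delta>)) \<longlonglongrightarrow> (1 + 0 / real n) / (2 - \<delta>)"
    using assms(1,6) by (intro tendsto_intros) auto
  \<comment> \<open>As \<open>n\<close> is fixed, \<open>ln (K k)\<close> is negligible against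
    \<open>ln (N k)\<close> just as against \<open>ln (real (M k))\<close>. For
    \<open>M k = 0\<close> both sides are 0 by the convention \<open>ln 0 = 0\<close>.\<close>
  moreover have "ln (N k) = real n * ln (real (M k))" for k
    using assms(1) by (cases "M k = 0") (auto simp: N ln_realpow)
  ultimately have lim_upper: "(\<lambda>k. (1 + ln (K k) / ln (N k)) / (2 - \<delta>)) \<longlonglongrightarrow> a"
    by (simp add: a_def mult.commute)
  have "(\<lambda>k. R_exponent (K k) (P k) \<delta>) \<longlonglongrightarrow> a"
    using tendsto_sandwich[OF _ upper lim_lower lim_upper] lower
    by (simp add: eventually_conj_iff)
  then show ?thesis
    unfolding P_def a_def by (rule tendsto_imp_asymp_equiv_const) (use assms(6) in simp)
qed

end
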